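(* Let $\zeta_3=e^{2\pi i/3}$ and $Y(t)=1-\left(\frac{1-t}{1+2t}\right)^3$. Then for all $u\in\mathbb{C}$ with $0<|u|$ sufficiently small, \[n(u^3)=\sum_{j=0}^{2} n\!\left(Y(\zeta_3^j u)\right).\]
   Context: $n(t)=\mathrm{m}\!\left(x^3+y^3+1-\frac{3}{t^{1/3}}xy\right)$, where $\mathrm{m}$ is the logarithmic Mahler measure $\mathrm{m}(P)=\int_0^1\int_0^1\log|P(e^{2\pi i\theta_1},e^{2\pi i\theta_2})|d\theta_1d\theta_2$ (independent of the choice of cube root). *)

theory Defs
  imports "HOL-Analysis.Analysis"
begin

definition mahler2 :: "(complex \<Rightarrow> complex \<Rightarrow> complex) \<Rightarrow> real" where
  "mahler2 P = (LINT p : {0..1} \<times> {0..1} | (lborel :: (real \<times> real) measure).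
      ln (cmod (P (cis (2 * pi * fst p)) (cis (2 * pi * snd p)))))"

text \<open>n(t) = m(x^3 + y^3 + 1 - 3 / t^(1/3) x y), using the principal cube root
  (the value is independent of the choice of cube root).\<close>
definition nfun :: "complex \<Rightarrow> real" where
  "nfun t = mahler2 (\<lambda>x y. x ^ 3 + y ^ 3 + 1 - (3 / (t powr (1 / 3))) * x * y)"

definition zeta3 :: complex where
  "zeta3 = cis (2 * pi / 3)"

definition Yfun :: "complex \<Rightarrow> complex" where
  "Yfun t = 1 - ((1 - t) / (1 + 2 * t)) ^ 3"

end

theory Submission
  imports Defs
begin

text \<open>
  Let \<open>a\<^sub>n = (3n)! / (n!\<^sup>3 27\<^sup>n)\<close>, \<open>F(t) = \<Sum> a\<^sub>n t\<^sup>n\<close> and \<open>L(t) = \<Sum>\<^sub>n\<^sub>\<ge>\<^sub>1 a\<^sub>n t\<^sup>n / n\<close>, so that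
  \<open>t L' = F - 1\<close>. Expanding the logarithm and reading off constant terms gives
  \<open>n(t) = ln 3 - ln |t| / 3 - Re L(t) / 3\<close> for \<open>0 < |t| < 1\<close>.
  The function \<open>F\<close> is the hypergeometric function \<open>F(1/3, 2/3; 1; t)\<close>, and the cubic transformation
  \<open>F(Y(x)) = (1 + 2x) F(x\<^sup>3)\<close> holds because both sides solve the same linear equation with a regular
  singularity at 0, whose solution regular at 0 is unique up to scaling. Consequently
  \<open>\<Phi>(u) = L(Y(u)) + ln (Y(u) / 9u)\<close> satisfies \<open>u \<Phi>'(u) = (1 - u)\<^sup>3 / (1 - u\<^sup>3) F(u\<^sup>3) - 1\<close>.
  Since the sum of \<open>(1 - \<zeta>\<^sup>j u)\<^sup>3\<close> over \<open>j = 0, 1, 2\<close> is \<open>3 (1 - u\<^sup>3)\<close>, the derivatives of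
  \<open>L(u\<^sup>3)\<close> and of the sum of the \<open>\<Phi>(\<zeta>\<^sup>j u)\<close> agree, and so do their values at 0.
\<close>

section \<open>The cubic hypergeometric series\<close>

definition cubic_coeff :: "nat \<Rightarrow> complex" where
  "cubic_coeff n = fact (3 * n) / (fact n ^ 3 * 27 ^ n)"

definition cubic_F :: "complex \<Rightarrow> complex" where
  "cubic_F t = (\<Sum>n. cubic_coeff n * t ^ n)"

definition cubic_F' :: "complex \<Rightarrow> complex" where
  "cubic_F' t = (\<Sum>n. diffs cubic_coeff n * t ^ n)"

text \<open>The term at n = 0 is 1 / 0 = 0 by the convention for division, so the series effectively
  starts at n = 1.\<close>

definition cubic_L :: "complex \<Rightarrow> complex" where
  "cubic_L t = (\<Sum>n. cubic_coeff n / of_nat n * t ^ n)"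

definition cubic_L' :: "complex \<Rightarrow> complex" where
  "cubic_L' t = (\<Sum>n. cubic_coeff (Suc n) * t ^ n)"

text \<open>The quasi-derivative of \<open>cubic_F\<close>; working with it avoids a second
  derivative throughout.\<close>

definition cubic_Q :: "complex \<Rightarrow> complex" where
  "cubic_Q t = t * (1 - t) * cubic_F' t"

lemma cubic_coeff_0 [simp]: "cubic_coeff 0 = 1"
  by (simp add: cubic_coeff_def)

text \<open>Of the three new factors of (3n+3)!, the factor 3n+3 cancels one n+1, and 27 normalises
  all three. This is the ratio of the hypergeometric series with parameters 1/3, 2/3; 1.\<close>

lemma cubic_coeff_Suc:
  "(of_nat (Suc n))\<^sup>2 * cubic_coeff (Suc n) =
     (of_nat n + 1/3) * (of_nat n + 2/3) * cubic_coeff n"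
proof -
  have e: "3 * Suc n = Suc (Suc (Suc (3 * n)))" by simp
  have f: "(fact (3 * Suc n) :: complex) =
      (3 * of_nat n + 3) * (3 * of_nat n + 2) * (3 * of_nat n + 1) * fact (3 * n)"
    unfolding e fact_Suc by (simp add: algebra_simps)
  have nz: "(of_nat n + 1 :: complex) \<noteq> 0"
    by (metis of_nat_Suc of_nat_neq_0 add.commute)
  have "(of_nat (Suc n))\<^sup>2 * cubic_coeff (Suc n) = (of_nat n + 1)\<^sup>2 *
      ((3 * of_nat n + 3) * (3 * of_nat n + 2) * (3 * of_nat n + 1) * fact (3 * n)
        / (((of_nat n + 1) * fact n) ^ 3 * 27 ^ Suc n))"
    unfolding cubic_coeff_def f by (simp add: algebra_simps)
  also have "\<dots> = (of_nat n + 1/3) * (of_nat n + 2/3) * cubic_coeff n"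
    unfolding cubic_coeff_def using nz by (simp add: divide_simps) algebra
  finally show ?thesis .
qed

text \<open>Each ratio of consecutive coefficients is at most 1. All the series therefore converge
  on the open unit disc.\<close>

lemma norm_cubic_coeff_le: "cmod (cubic_coeff n) \<le> 1"
proof (induction n)
  case (Suc n)
  have "(real n + 1)\<^sup>2 * cmod (cubic_coeff (Suc n)) =
      cmod ((of_nat (Suc n))\<^sup>2 * cubic_coeff (Suc n))"
    by (simp add: norm_mult norm_power del: of_nat_Suc)
  also have "\<dots> = cmod ((complex_of_real ((real n + 1/3) * (real n + 2/3))) * cubic_coeff n)"
    unfolding cubic_coeff_Suc by simp
  also have "\<dots> = ((real n + 1/3) * (real n + 2/3)) * cmod (cubic_coeff n)"
    unfolding norm_mult norm_of_real by simp
  also have "\<dots> \<le> (real n + 1/3) * (real n + 2/3)"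
    using Suc by (simp add: mult_left_le)
  also have "\<dots> \<le> (real n + 1)\<^sup>2 * 1" by (simp add: power2_eq_square algebra_simps)
  finally show ?case
    by (subst (asm) mult_le_cancel_left_pos) auto
qed simp

lemma summable_bounded_coeffs:
  fixes c :: "nat \<Rightarrow> complex"
  assumes "\<And>n. cmod (c n) \<le> 1" "cmod t < 1"
  shows "summable (\<lambda>n. c n * t ^ n)"
proof (rule summable_comparison_test')
  show "summable (\<lambda>n. cmod t ^ n)" using assms by simp
  show "norm (c n * t ^ n) \<le> cmod t ^ n" if "n \<ge> 0" for n
    using assms(1)[of n] by (simp add: norm_mult norm_power mult_left_le_one_le)
qed

lemmas summable_cubic_F = summable_bounded_coeffs[OF norm_cubic_coeff_le]

lemma DERIV_cubic_F [derivative_intros]: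
  assumes "(f has_field_derivative f') (at x within S)" "cmod (f x) < 1"
  shows "((\<lambda>x. cubic_F (f x)) has_field_derivative (cubic_F' (f x) * f')) (at x within S)"
proof (rule DERIV_chain2[OF _ assms(1)])
  show "(cubic_F has_field_derivative cubic_F' (f x)) (at (f x))"
    unfolding cubic_F_def[abs_def] cubic_F'_def
    by (rule termdiffs_strong'[OF summable_cubic_F assms(2)])
qed

lemma cubic_F_0 [simp]: "cubic_F 0 = 1"
  by (simp add: cubic_F_def)

lemma cubic_F'_0: "cubic_F' 0 = 2/9"
  using powser_zero[of "diffs cubic_coeff"]
  by (simp add: cubic_F'_def diffs_def cubic_coeff_def fact_numeral)

lemma DERIV_cubic_L [derivative_intros]:
  assumes "(f has_field_derivative f') (at x within S)" "cmod (f x) < 1"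
  shows "((\<lambda>x. cubic_L (f x)) has_field_derivative (cubic_L' (f x) * f')) (at x within S)"
proof (rule DERIV_chain2[OF _ assms(1)])
  have "cmod (cubic_coeff n / of_nat n) \<le> 1" for n
    using norm_cubic_coeff_le[of n]
    by (cases n) (auto simp: norm_divide divide_simps simp del: of_nat_Suc)
  note s = summable_bounded_coeffs[OF this]
  have "diffs (\<lambda>n. cubic_coeff n / of_nat n) = (\<lambda>n. cubic_coeff (Suc n))"
    by (simp add: fun_eq_iff diffs_def del: of_nat_Suc)
  thus "(cubic_L has_field_derivative cubic_L' (f x)) (at (f x))"
    unfolding cubic_L_def[abs_def] cubic_L'_def
    using termdiffs_strong'[of 1 "\<lambda>n. cubic_coeff n / of_nat n", OF s assms(2)] by simp
qed

lemma cubic_L_0 [simp]: "cubic_L 0 = 0"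
  using powser_zero[of "\<lambda>n. cubic_coeff n / of_nat n"] by (simp add: cubic_L_def)

lemma cubic_L'_mult:
  assumes "cmod t < 1"
  shows "t * cubic_L' t = cubic_F t - 1"
proof -
  have "(\<lambda>n. cubic_coeff n * t ^ n) sums cubic_F t"
    unfolding cubic_F_def using summable_cubic_F[OF assms] by (rule summable_sums)
  hence F: "(\<lambda>n. cubic_coeff (Suc n) * t ^ Suc n) sums (cubic_F t - 1)"
    using sums_Suc_iff[of "\<lambda>n. cubic_coeff n * t ^ n"] by simp
  have "(\<lambda>n. cubic_coeff (Suc n) * t ^ n) sums cubic_L' t"
    unfolding cubic_L'_def
    by (intro summable_sums summable_bounded_coeffs norm_cubic_coeff_le assms)
  from sums_mult[OF this, of t] have "(\<lambda>n. cubic_coeff (Suc n) * t ^ Suc n) sums (t * cubic_L' t)"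
    by (simp add: mult_ac)
  with F show ?thesis by (metis sums_unique2)
qed

text \<open>The hypergeometric equation of the cubic theory in self-adjoint form,
  \<open>(t (1 - t) F')' = 2/9 F\<close>.\<close>

lemma DERIV_cubic_Q [derivative_intros]:
  assumes "(f has_field_derivative f') (at x within S)" "cmod (f x) < 1"
  shows "((\<lambda>x. cubic_Q (f x)) has_field_derivative (2/9 * cubic_F (f x) * f')) (at x within S)"
proof (rule DERIV_chain2[OF _ assms(1)])
  \<comment> \<open>Power series coefficients of t (1 - t) F'. At n = 0 the truncated n - 1 is 0, so
    \<open>e 0\<close> is 0 as it should be.\<close>
  define e where "e n = of_nat n * cubic_coeff n - of_nat (n - 1) * cubic_coeff (n - 1)" for n
  have e: "(\<lambda>n. e n * t ^ n) sums cubic_Q t" if t: "cmod t < 1" for t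
  proof -
    have "(\<lambda>n. diffs cubic_coeff n * t ^ n) sums cubic_F' t"
      unfolding cubic_F'_def
      by (rule summable_sums, rule termdiff_converges[OF t summable_cubic_F])
    from sums_mult[OF this, of t]
    have "(\<lambda>n. (of_nat (Suc n) * cubic_coeff (Suc n)) * t ^ Suc n) sums (t * cubic_F' t)"
      by (simp add: diffs_def mult_ac)
    hence s1: "(\<lambda>n. of_nat n * cubic_coeff n * t ^ n) sums (t * cubic_F' t)"
      by (subst (asm) sums_Suc_iff) simp
    from sums_mult[OF this, of t]
    have "(\<lambda>n. of_nat (Suc n - 1) * cubic_coeff (Suc n - 1) * t ^ Suc n) sums (t * (t * cubic_F' t))"
      by (simp add: mult_ac)
    hence "(\<lambda>n. of_nat (n - 1) * cubic_coeff (n - 1) * t ^ n) sums (t * (t * cubic_F' t))"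
      by (subst (asm) sums_Suc_iff) simp
    from sums_diff[OF s1 this] show ?thesis
      by (simp add: e_def cubic_Q_def algebra_simps)
  qed
  \<comment> \<open>By the recurrence this is (n + 1/3)(n + 2/3) - n (n + 1) = 2/9, times the
    coefficient.\<close>
  have d: "diffs e n = 2/9 * cubic_coeff n" for n
  proof -
    have "diffs e n = (of_nat (Suc n))\<^sup>2 * cubic_coeff (Suc n)
        - of_nat (Suc n) * of_nat n * cubic_coeff n"
      by (simp add: diffs_def e_def algebra_simps power2_eq_square)
    also have "\<dots> = 2/9 * cubic_coeff n"
      unfolding cubic_coeff_Suc by (simp add: field_simps)
    finally show ?thesis .
  qed
  have "((\<lambda>t. \<Sum>n. e n * t ^ n) has_field_derivative (\<Sum>n. diffs e n * f x ^ n)) (at (f x))"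
    using e assms(2) by (intro termdiffs_strong'[of 1]) (auto simp: sums_iff)
  also have "(\<Sum>n. diffs e n * f x ^ n) = 2/9 * cubic_F (f x)"
    unfolding d cubic_F_def
    using suminf_mult[OF summable_cubic_F[OF assms(2)], of "2/9"] by (simp add: mult.assoc)
  finally have D: "((\<lambda>t. \<Sum>n. e n * t ^ n) has_field_derivative 2/9 * cubic_F (f x)) (at (f x))" .
  show "(cubic_Q has_field_derivative 2/9 * cubic_F (f x)) (at (f x))"
    by (rule has_field_derivative_transform_within_open[OF D, of "ball 0 1"])
       (use e assms(2) in \<open>auto simp: sums_iff\<close>)
qed

section \<open>The cubic transformation\<close>

text \<open>
  If \<open>M\<close> is the maximum of \<open>|W|\<close> on the disc, then \<open>|S(x)| \<le> K M |x|\<close>, hence \<open>|W'| \<le> K M / c\<close> and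
  \<open>M \<le> \<rho> K M / c\<close>, which forces \<open>M = 0\<close>. The value of \<open>W'\<close> at 0 must be prescribed separately,
  because the equation for \<open>S\<close> is vacuous there.
\<close>

lemma singular_linear_system_unique:
  fixes W W' S \<alpha> B :: "complex \<Rightarrow> complex"
  assumes \<rho>: "0 < \<rho>" and c: "0 < c" "\<rho> * K < c"
    and W: "\<And>x. cmod x \<le> \<rho> \<Longrightarrow> (W has_field_derivative W' x) (at x within cball 0 \<rho>)"
    and S: "\<And>x. cmod x \<le> \<rho> \<Longrightarrow> (S has_field_derivative B x * W x) (at x within cball 0 \<rho>)"
    and eq: "\<And>x. cmod x \<le> \<rho> \<Longrightarrow> S x = x * \<alpha> x * W' x"
    and B: "\<And>x. cmod x \<le> \<rho> \<Longrightarrow> cmod (B x) \<le> K"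
    and \<alpha>: "\<And>x. cmod x \<le> \<rho> \<Longrightarrow> c \<le> cmod (\<alpha> x)"
    and init: "W 0 = 0" "W' 0 = 0"
    and x: "cmod x \<le> \<rho>"
  shows "W x = 0"
proof -
  have "continuous_on (cball 0 \<rho>) (\<lambda>x. cmod (W x))"
    by (intro continuous_on_norm DERIV_continuous_on[of _ W W'] W) simp
  then obtain m where m: "cmod m \<le> \<rho>" "\<And>y. cmod y \<le> \<rho> \<Longrightarrow> cmod (W y) \<le> cmod (W m)"
    using continuous_attains_sup[of "cball 0 \<rho>" "\<lambda>x. cmod (W x)"] \<rho> by auto
  define M where "M = cmod (W m)"
  have K: "0 \<le> K" using order_trans[OF norm_ge_zero B[of 0]] \<rho> by simp
  have M: "0 \<le> M" by (simp add: M_def)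
  have S_le: "cmod (S y) \<le> K * M * cmod y" if y: "cmod y \<le> \<rho>" for y
  proof -
    have "cmod (S y - S 0) \<le> K * M * cmod (y - 0)"
    proof (rule field_differentiable_bound[of "cball 0 \<rho>" S "\<lambda>x. B x * W x"])
      show "cmod (B z * W z) \<le> K * M" if "z \<in> cball 0 \<rho>" for z
        using that B[of z] m(2)[of z] K by (auto simp: norm_mult M_def intro!: mult_mono)
    qed (use S y \<rho> in auto)
    \<comment> \<open>The relation \<open>eq\<close> at 0 gives S 0 = 0.\<close>
    thus ?thesis using eq[of 0] \<rho> by simp
  qed
  have W'_le: "cmod (W' y) \<le> K * M / c" if y: "cmod y \<le> \<rho>" for y
  proof (cases "y = 0")
    case False
    have "cmod y * (c * cmod (W' y)) \<le> cmod y * (cmod (\<alpha> y) * cmod (W' y))"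
      using \<alpha>[OF y] by (intro mult_left_mono mult_right_mono) auto
    also have "\<dots> = cmod (S y)" by (simp add: eq[OF y] norm_mult)
    also have "\<dots> \<le> cmod y * (K * M)" using S_le[OF y] by (simp add: mult_ac)
    finally have "c * cmod (W' y) \<le> K * M" using False by simp
    thus ?thesis using c by (simp add: field_simps)
  qed (use init K M c in auto)
  have "cmod (W m - W 0) \<le> K * M / c * cmod (m - 0)"
    by (rule field_differentiable_bound[of "cball 0 \<rho>" W W'])
       (use W W'_le m(1) \<rho> in auto)
  hence "M \<le> K * M / c * cmod m" using init by (simp add: M_def)
  also have "\<dots> \<le> K * M / c * \<rho>" using m(1) K M c by (intro mult_left_mono) auto
  finally have "M * c \<le> M * (\<rho> * K)" using c by (simp add: field_simps)
  hence "M = 0" using c(2) M by (metis mult_le_cancel_left_pos not_less order_le_less)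
  thus ?thesis using m(2)[OF x] by (simp add: M_def)
qed

section \<open>Estimates on the disc of radius 1/100, and the map Y\<close>

lemma small_disc_bounds:
  assumes "cmod x \<le> 1/100"
  shows "cmod (1 + 2 * x) \<ge> 98/100" "cmod (1 + 2 * x) \<le> 102/100"
    "cmod (1 - x) \<le> 101/100" "cmod (1 - x) \<ge> 99/100"
    "cmod (1 + x + x\<^sup>2) \<le> 102/100" "cmod (1 + x + x\<^sup>2) \<ge> 98/100"
    "cmod (x ^ 3) \<le> 1/1000000"
proof -
  have x2: "cmod (x\<^sup>2) \<le> (1/100)\<^sup>2"
    unfolding norm_power using assms by (intro power_mono) auto
  have "cmod (x ^ 3) \<le> (1/100) ^ 3"
    unfolding norm_power using assms by (intro power_mono) auto
  thus "cmod (x ^ 3) \<le> 1/1000000" by (simp add: power3_eq_cube)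
  show "cmod (1 + 2 * x) \<ge> 98/100" "cmod (1 + 2 * x) \<le> 102/100"
    using norm_triangle_ineq[of 1 "2 * x"] norm_diff_ineq[of 1 "2 * x"] assms
    by (auto simp: norm_mult)
  show "cmod (1 - x) \<le> 101/100" "cmod (1 - x) \<ge> 99/100"
    using norm_triangle_ineq4[of 1 x] norm_triangle_ineq2[of 1 x] assms by auto
  have "cmod (x + x\<^sup>2) \<le> 2/100"
    using norm_triangle_ineq[of x "x\<^sup>2"] assms x2 by (simp add: power2_eq_square)
  thus "cmod (1 + x + x\<^sup>2) \<le> 102/100" "cmod (1 + x + x\<^sup>2) \<ge> 98/100"
    using norm_triangle_ineq[of 1 "x + x\<^sup>2"] norm_diff_ineq[of 1 "x + x\<^sup>2"]
    by (auto simp: add.assoc)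
qed

lemma small_disc_nonzero:
  assumes "cmod x \<le> 1/100"
  shows "1 + 2 * x \<noteq> 0" "1 - x \<noteq> 0" "1 + x + x\<^sup>2 \<noteq> 0" "1 - x ^ 3 \<noteq> 0"
proof -
  show nz: "1 + 2 * x \<noteq> 0" "1 - x \<noteq> 0" "1 + x + x\<^sup>2 \<noteq> 0"
    using small_disc_bounds[OF assms] by (auto simp del: norm_mult_numeral1)
  have "1 - x ^ 3 = (1 - x) * (1 + x + x\<^sup>2)" by algebra
  thus "1 - x ^ 3 \<noteq> 0" using nz by simp
qed

text \<open>Difference of cubes: (1 + 2x)^3 - (1 - x)^3 = 9x (1 + x + x^2). It shows the simple zero
  of Y at 0.\<close>

lemma Yfun_eq:
  assumes "1 + 2 * x \<noteq> 0"
  shows "Yfun x = 9 * x * (1 + x + x\<^sup>2) / (1 + 2 * x) ^ 3"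
  unfolding Yfun_def power_divide using assms by (simp add: divide_simps) algebra

lemma one_minus_Yfun: "1 - Yfun x = (1 - x) ^ 3 / (1 + 2 * x) ^ 3"
  by (simp add: Yfun_def power_divide)

lemma norm_Yfun_less_1:
  assumes "cmod x \<le> 1/100"
  shows "cmod (Yfun x) < 1"
proof -
  note b = small_disc_bounds[OF assms]
  have "cmod (Yfun x) = 9 * cmod x * cmod (1 + x + x\<^sup>2) / cmod (1 + 2 * x) ^ 3"
    by (simp add: Yfun_eq[OF small_disc_nonzero(1)[OF assms]] norm_divide norm_mult norm_power)
  also have "\<dots> \<le> 9 * (1/100) * (102/100) / (98/100) ^ 3"
    using assms b by (intro frac_le mult_mono power_mono) auto
  also have "\<dots> < 1" by (simp add: power3_eq_cube)
  finally show ?thesis .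
qed

lemma DERIV_Yfun:
  assumes "1 + 2 * x \<noteq> 0"
  shows "(Yfun has_field_derivative 9 * (1 - x)\<^sup>2 / (1 + 2 * x) ^ 4) (at x within A)"
proof -
  have "(Yfun has_field_derivative
      - (3 * ((1 - x) / (1 + 2 * x))\<^sup>2 * ((- 1 * (1 + 2 * x) - (1 - x) * 2)
          / ((1 + 2 * x) * (1 + 2 * x))))) (at x within A)"
    unfolding Yfun_def[abs_def]
    by (rule derivative_eq_intros refl assms | simp)+
  also have "- (3 * ((1 - x) / (1 + 2 * x))\<^sup>2 * ((- 1 * (1 + 2 * x) - (1 - x) * 2)
          / ((1 + 2 * x) * (1 + 2 * x)))) = 9 * (1 - x)\<^sup>2 / (1 + 2 * x) ^ 4"
    using assms unfolding power_divide by (simp add: divide_simps) algebra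
  finally show ?thesis .
qed

lemma cubic_transformation:
  assumes x: "cmod x \<le> 1/100"
  shows "cubic_F (Yfun x) = (1 + 2 * x) * cubic_F (x ^ 3)"
proof -
  define W where "W x = cubic_F (Yfun x) - (1 + 2 * x) * cubic_F (x ^ 3)" for x
  define W' where "W' x = cubic_F' (Yfun x) * (9 * (1 - x)\<^sup>2 / (1 + 2 * x) ^ 4)
    - (2 * cubic_F (x ^ 3) + (1 + 2 * x) * (cubic_F' (x ^ 3) * (3 * x\<^sup>2)))" for x
  \<comment> \<open>This is the product x \<open>\<alpha>\<close> W' rewritten through
    \<open>cubic_Q\<close>, so that it can be differentiated with
    \<open>DERIV_cubic_Q\<close>.\<close>
  define S where "S x = cubic_Q (Yfun x) - (2 * x * (1 - x ^ 3) / (1 + 2 * x)\<^sup>2 * cubic_F (x ^ 3)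
    + 3 * cubic_Q (x ^ 3) / (1 + 2 * x))" for x
  \<comment> \<open>Chosen so that x \<open>\<alpha>\<close> = Y (1 - Y) / Y', which turns d/dx into
    t (1 - t) d/dt at t = Y(x).\<close>
  define \<alpha> where "\<alpha> x = (1 - x ^ 3) / (1 + 2 * x)\<^sup>2" for x :: complex
  \<comment> \<open>Equal to 2/9 Y', as the self-adjoint equation at t = Y(x) requires.\<close>
  define B where "B x = 2 * (1 - x)\<^sup>2 / (1 + 2 * x) ^ 4" for x :: complex
  have "W x = 0"
  proof (rule singular_linear_system_unique[where \<rho> = "1/100" and c = "1/2" and K = 3 and W = W
        and W' = W' and S = S and \<alpha> = \<alpha> and B = B])
    fix x :: complex assume x: "cmod x \<le> 1/100"
    note b = small_disc_bounds[OF x] and nz = small_disc_nonzero[OF x]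
    have x3: "cmod (x ^ 3) < 1" using b by linarith
    show "(W has_field_derivative W' x) (at x within cball 0 (1/100))"
      unfolding W_def[abs_def] W'_def
      by (auto intro!: derivative_eq_intros DERIV_Yfun nz norm_Yfun_less_1 x x3)
    show "S x = x * \<alpha> x * W' x"
    proof -
      have "cubic_Q (Yfun x) = 9 * x * (1 + x + x\<^sup>2) / (1 + 2 * x) ^ 3
          * ((1 - x) ^ 3 / (1 + 2 * x) ^ 3) * cubic_F' (Yfun x)"
        unfolding cubic_Q_def one_minus_Yfun by (simp add: Yfun_eq nz)
      thus ?thesis
        unfolding S_def \<alpha>_def W'_def cubic_Q_def[of "x ^ 3"] using nz
        by (simp add: divide_simps) algebra
    qed
    show "(S has_field_derivative B x * W x) (at x within cball 0 (1/100))"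
    proof -
      have num: "((\<lambda>x. 2 * x * (1 - x ^ 3)) has_field_derivative 2 - 8 * x ^ 3)
          (at x within cball 0 (1/100))"
        by (auto intro!: derivative_eq_intros simp: algebra_simps power_numeral_reduce)
      have den: "((\<lambda>x. (1 + 2 * x)\<^sup>2) has_field_derivative 4 * (1 + 2 * x))
          (at x within cball 0 (1/100))"
        by (auto intro!: derivative_eq_intros simp: algebra_simps)
      have "(1 + 2 * x)\<^sup>2 \<noteq> 0" using nz(1) by simp
      from DERIV_divide[OF num den this]
      have D: "((\<lambda>x. 2 * x * (1 - x ^ 3) / (1 + 2 * x)\<^sup>2) has_field_derivative
          (2 - 8 * x ^ 3) / (1 + 2 * x)\<^sup>2 - 8 * x * (1 - x ^ 3) / (1 + 2 * x) ^ 3)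
          (at x within cball 0 (1/100))"
        by (rule DERIV_cong) (use nz(1) in \<open>simp add: divide_simps; algebra\<close>)
      have F: "((\<lambda>x. cubic_F (x ^ 3)) has_field_derivative cubic_F' (x ^ 3) * (3 * x\<^sup>2))
          (at x within cball 0 (1/100))"
        using x3 by (auto intro!: derivative_eq_intros)
      have Q: "((\<lambda>x. cubic_Q (x ^ 3)) has_field_derivative 2/9 * cubic_F (x ^ 3) * (3 * x\<^sup>2))
          (at x within cball 0 (1/100))"
        using x3 by (auto intro!: derivative_eq_intros)
      have "((\<lambda>x. 1 + 2 * x) has_field_derivative 2) (at x within cball 0 (1/100))"
        by (auto intro!: derivative_eq_intros)
      from DERIV_divide[OF DERIV_cmult[OF Q, of 3] this nz(1)]
      have Q': "((\<lambda>x. 3 * cubic_Q (x ^ 3) / (1 + 2 * x)) has_field_derivative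
          3 * (2/9 * cubic_F (x ^ 3) * (3 * x\<^sup>2)) / (1 + 2 * x)
             - 6 * cubic_Q (x ^ 3) / (1 + 2 * x)\<^sup>2) (at x within cball 0 (1/100))"
        by (rule DERIV_cong) (use nz(1) in \<open>simp add: divide_simps; algebra\<close>)
      have "((\<lambda>x. cubic_Q (Yfun x)) has_field_derivative
          2/9 * cubic_F (Yfun x) * (9 * (1 - x)\<^sup>2 / (1 + 2 * x) ^ 4))
          (at x within cball 0 (1/100))"
        by (rule DERIV_cubic_Q[OF DERIV_Yfun[OF nz(1)] norm_Yfun_less_1[OF x]])
      from DERIV_diff[OF this DERIV_add[OF DERIV_mult[OF D F] Q']]
      have "(S has_field_derivative
          2/9 * cubic_F (Yfun x) * (9 * (1 - x)\<^sup>2 / (1 + 2 * x) ^ 4)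
          - ((2 - 8 * x ^ 3) / (1 + 2 * x)\<^sup>2 * cubic_F (x ^ 3)
             - 8 * x * (1 - x ^ 3) / (1 + 2 * x) ^ 3 * cubic_F (x ^ 3)
             + 2 * x * (1 - x ^ 3) / (1 + 2 * x)\<^sup>2 * (cubic_F' (x ^ 3) * (3 * x\<^sup>2))
             + 3 * (2/9 * cubic_F (x ^ 3) * (3 * x\<^sup>2)) / (1 + 2 * x)
             - 6 * cubic_Q (x ^ 3) / (1 + 2 * x)\<^sup>2)) (at x within cball 0 (1/100))"
        unfolding S_def[abs_def] by (rule DERIV_cong) (simp add: algebra_simps)
      \<comment> \<open>The contributions of F'(x^3) cancel, and the coefficient of F(x^3) collapses
        to 2 (1 - x)^2 / (1 + 2x)^3 = (1 + 2x) B.\<close>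
      also have "(2/9 * cubic_F (Yfun x) * (9 * (1 - x)\<^sup>2 / (1 + 2 * x) ^ 4)
          - ((2 - 8 * x ^ 3) / (1 + 2 * x)\<^sup>2 * cubic_F (x ^ 3)
             - 8 * x * (1 - x ^ 3) / (1 + 2 * x) ^ 3 * cubic_F (x ^ 3)
             + 2 * x * (1 - x ^ 3) / (1 + 2 * x)\<^sup>2 * (cubic_F' (x ^ 3) * (3 * x\<^sup>2))
             + 3 * (2/9 * cubic_F (x ^ 3) * (3 * x\<^sup>2)) / (1 + 2 * x)
             - 6 * cubic_Q (x ^ 3) / (1 + 2 * x)\<^sup>2)) = B x * W x"
        unfolding B_def W_def cubic_Q_def using nz(1)
        by (simp add: divide_simps) algebra
      finally show ?thesis .
    qed
    have "cmod (B x) = 2 * cmod (1 - x) ^ 2 / cmod (1 + 2 * x) ^ 4"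
      by (simp add: B_def norm_divide norm_mult norm_power)
    also have "\<dots> \<le> 2 * (101/100) ^ 2 / (98/100) ^ 4"
      using b by (intro frac_le mult_mono power_mono) auto
    also have "\<dots> \<le> 3" by (simp add: power_numeral_reduce)
    finally show "cmod (B x) \<le> 3" .
    have "1/2 \<le> (9/10) / (102/100 :: real) ^ 2" by (simp add: power_numeral_reduce)
    also have "\<dots> \<le> cmod (1 - x ^ 3) / cmod (1 + 2 * x) ^ 2"
      using b norm_triangle_ineq2[of 1 "x ^ 3"] nz by (intro frac_le power_mono) auto
    finally show "1/2 \<le> cmod (\<alpha> x)"
      by (simp add: \<alpha>_def norm_divide norm_power)
  next
    \<comment> \<open>Here W' 0 = 9 F'(0) - 2, which vanishes because F'(0) = 2/9.\<close>
    show "W 0 = 0" "W' 0 = 0"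
      by (simp_all add: W_def W'_def Yfun_def cubic_F'_0)
  qed (use x in auto)
  thus ?thesis by (simp add: W_def)
qed

section \<open>Mahler measure of the Hesse pencil\<close>

lemma integral_character:
  "(LINT \<theta>:{0..1}|lborel. cis (2 * pi * of_int a * \<theta>)) = (if a = 0 then 1 else 0)"
proof (cases "a = 0")
  case True
  thus ?thesis by (simp add: set_integral_const)
next
  case False
  define c where "c = 2 * pi * real_of_int a"
  have c: "c \<noteq> 0" using False by (simp add: c_def)
  have cis1: "cis c = 1"
    unfolding c_def using cis_multiple_2pi[of "of_int a"] by (simp add: mult_ac)
  have "(\<integral>\<theta>. indicator {0..1} \<theta> *\<^sub>R cis (c * \<theta>) \<partial>lborel) =
      cis (c * 1) / (\<i> * c) - cis (c * 0) / (\<i> * c)"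
  proof (rule integral_FTC_Icc)
    fix \<theta> :: real
    have "((\<lambda>z. exp (\<i> * c * z) / (\<i> * c)) has_field_derivative exp (\<i> * c * \<theta>))
        (at (of_real \<theta>))"
      using c by (auto intro!: derivative_eq_intros)
    hence "((\<lambda>\<theta>. exp (\<i> * c * of_real \<theta>) / (\<i> * c)) has_vector_derivative
        exp (\<i> * c * of_real \<theta>)) (at \<theta> within {0..1})"
      by (rule has_vector_derivative_real_field)
    thus "((\<lambda>\<theta>. cis (c * \<theta>) / (\<i> * c)) has_vector_derivative cis (c * \<theta>))
        (at \<theta> within {0..1})"
      by (simp add: cis_conv_exp mult_ac)
  qed (auto intro!: continuous_intros)
  thus ?thesis using False cis1 by (simp add: set_lebesgue_integral_def c_def)
qed

lemma integral_torus_character: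
  "has_bochner_integral (lborel :: (real \<times> real) measure)
     (\<lambda>p. indicator ({0..1} \<times> {0..1}) p *\<^sub>R
        (cis (2 * pi * of_int a * fst p) * cis (2 * pi * of_int b * snd p)))
     (if a = 0 \<and> b = 0 then 1 else 0)"
proof -
  let ?f = "\<lambda>p :: real \<times> real. indicator ({0..1} \<times> {0..1}) p *\<^sub>R
        (cis (2 * pi * of_int a * fst p) * cis (2 * pi * of_int b * snd p))"
  have int: "integrable lborel ?f"
    by (intro borel_integrable_compact compact_Times continuous_intros) auto
  have "integral\<^sup>L lborel ?f = integral\<^sup>L (lborel \<Otimes>\<^sub>M lborel) ?f"
    by (simp add: lborel_prod)
  also have "\<dots> = (\<integral>x. (\<integral>y. ?f (x, y) \<partial>lborel) \<partial>lborel)"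
    by (rule lborel_pair.integral_fst'[symmetric]) (use int in \<open>simp add: lborel_prod\<close>)
  also have "\<dots> = (\<integral>x. (\<integral>y. (indicator {0..1} x *\<^sub>R cis (2 * pi * of_int a * x)) *
      (indicator {0..1} y *\<^sub>R cis (2 * pi * of_int b * y)) \<partial>lborel) \<partial>lborel)"
    by (intro Bochner_Integration.integral_cong refl) (auto simp: indicator_def)
  also have "\<dots> = (if a = 0 then 1 else 0) * (if b = 0 then 1 else 0)"
    using integral_character[of a] integral_character[of b]
    by (simp only: set_lebesgue_integral_def integral_mult_right_zero integral_mult_left_zero)
  finally show ?thesis using int by (simp add: has_bochner_integral_iff)
qed

definition hesse_ratio :: "real \<times> real \<Rightarrow> complex" where
  "hesse_ratio p = (cis (2 * pi * fst p) ^ 3 + cis (2 * pi * snd p) ^ 3 + 1)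
     / (cis (2 * pi * fst p) * cis (2 * pi * snd p))"

lemma norm_hesse_ratio_le: "cmod (hesse_ratio p) \<le> 3"
proof -
  have "cmod (cis (2 * pi * fst p) ^ 3 + cis (2 * pi * snd p) ^ 3 + 1)
      \<le> cmod (cis (2 * pi * fst p) ^ 3) + cmod (cis (2 * pi * snd p) ^ 3) + cmod 1"
    by (intro order_trans[OF norm_triangle_ineq] add_right_mono norm_triangle_ineq)
  thus ?thesis by (simp add: hesse_ratio_def norm_divide norm_mult norm_power)
qed

text \<open>Two applications of the binomial theorem; division by x^m y^m shifts the exponents 3i
  and 3j by m.\<close>

lemma hesse_ratio_power:
  "hesse_ratio p ^ m = (\<Sum>i\<le>m. \<Sum>j\<le>m - i. of_nat ((m choose i) * (m - i choose j)) *
     (cis (2 * pi * of_int (3 * int i - int m) * fst p) *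
      cis (2 * pi * of_int (3 * int j - int m) * snd p)))"
proof -
  define x y where "x = cis (2 * pi * fst p)" and "y = cis (2 * pi * snd p)"
  have ch: "cis (2 * pi * of_int (3 * int i - int m) * \<theta>)
      = (cis (2 * pi * \<theta>) ^ 3) ^ i / cis (2 * pi * \<theta>) ^ m" for i \<theta>
  proof -
    have "(cis (2 * pi * \<theta>) ^ 3) ^ i / cis (2 * pi * \<theta>) ^ m =
       cis (real (3 * i) * (2 * pi * \<theta>) - real m * (2 * pi * \<theta>))"
      by (simp add: Complex.DeMoivre cis_divide mult_ac)
    also have "real (3 * i) * (2 * pi * \<theta>) - real m * (2 * pi * \<theta>)
        = 2 * pi * of_int (3 * int i - int m) * \<theta>"
      by (simp add: algebra_simps)
    finally show ?thesis by simp
  qed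
  have "hesse_ratio p ^ m = (x ^ 3 + (y ^ 3 + 1)) ^ m / (x ^ m * y ^ m)"
    by (simp add: hesse_ratio_def x_def y_def power_divide power_mult_distrib add.assoc)
  also have "(x ^ 3 + (y ^ 3 + 1)) ^ m = (\<Sum>i\<le>m. \<Sum>j\<le>m - i.
      of_nat (m choose i) * (x ^ 3) ^ i * (of_nat (m - i choose j) * (y ^ 3) ^ j))"
    by (simp add: binomial_ring[of "x ^ 3"] binomial_ring[of "y ^ 3"] sum_distrib_left)
  also have "\<dots> / (x ^ m * y ^ m) = (\<Sum>i\<le>m. \<Sum>j\<le>m - i. of_nat ((m choose i) * (m - i choose j)) *
     ((x ^ 3) ^ i / x ^ m * ((y ^ 3) ^ j / y ^ m)))"
    by (simp add: sum_divide_distrib mult_ac)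
  finally show ?thesis unfolding ch x_def y_def .
qed

text \<open>Only i = j = m/3 gives the trivial character. For m = 3n its weight is the multinomial
  coefficient (3n)! / n!^3, that is, 27^n times \<open>cubic_coeff n\<close>.\<close>

lemma integral_hesse_ratio_power:
  "has_bochner_integral lborel
     (\<lambda>p. indicator ({0..1} \<times> {0..1}) p *\<^sub>R hesse_ratio p ^ m)
     (if 3 dvd m then fact m / fact (m div 3) ^ 3 else 0)"
proof -
  have "has_bochner_integral lborel
     (\<lambda>p. \<Sum>i\<le>m. \<Sum>j\<le>m - i. of_nat ((m choose i) * (m - i choose j)) *
       (indicator ({0..1} \<times> {0..1}) p *\<^sub>R
         (cis (2 * pi * of_int (3 * int i - int m) * fst p) *
          cis (2 * pi * of_int (3 * int j - int m) * snd p))))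
     (\<Sum>i\<le>m. \<Sum>j\<le>m - i. of_nat ((m choose i) * (m - i choose j)) *
       (if 3 * int i - int m = 0 \<and> 3 * int j - int m = 0 then 1 else 0))"
    by (intro has_bochner_integral_sum has_bochner_integral_mult_right integral_torus_character)
  also have "(\<Sum>i\<le>m. \<Sum>j\<le>m - i. of_nat ((m choose i) * (m - i choose j)) *
       (if 3 * int i - int m = 0 \<and> 3 * int j - int m = 0 then 1 else 0)) =
     (if 3 dvd m then fact m / fact (m div 3) ^ 3 else 0 :: complex)"
  proof (cases "3 dvd m")
    case True
    then obtain n where n: "m = 3 * n" by auto
    have "(\<Sum>i\<le>m. \<Sum>j\<le>m - i. of_nat ((m choose i) * (m - i choose j)) *
       (if 3 * int i - int m = 0 \<and> 3 * int j - int m = 0 then 1 else 0)) =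
       (\<Sum>i\<le>m. if i = n then \<Sum>j\<le>m - i. if j = n then
          of_nat ((m choose i) * (m - i choose j)) else 0 else (0 :: complex))"
      by (intro sum.cong refl) (auto simp: n if_distrib[of "\<lambda>z. _ * z"] cong: if_cong intro!: sum.cong sum.neutral)
    also have "\<dots> = of_nat ((3 * n choose n) * (2 * n choose n))"
      by (simp add: n)
    also have "\<dots> = fact m / fact n ^ 3"
      by (simp add: n binomial_fact power3_eq_cube)
    finally show ?thesis by (simp add: n)
  next
    case False
    have "3 * int i - int m \<noteq> 0" for i using False by presburger
    thus ?thesis using False by simp
  qed
  finally show ?thesis
    by (simp add: hesse_ratio_power scaleR_sum_right)
qed

section \<open>Termwise integration of the logarithm and the formula for n(t)\<close>

lemma has_bochner_integral_const_unit_square: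
  "has_bochner_integral lborel (\<lambda>p :: real \<times> real. indicator ({0..1} \<times> {0..1}) p *\<^sub>R c) (c :: real)"
proof -
  have eq: "{0..1} \<times> {0..1} = cbox (0 :: real, 0 :: real) (1, 1)"
    by (simp add: cbox_Pair_eq)
  have "measure lborel (cbox (0 :: real, 0 :: real) (1, 1)) = 1"
    by (simp add: content_Pair measure_completion[symmetric])
  thus ?thesis
    unfolding eq using emeasure_lborel_cbox_finite[of "(0 :: real, 0 :: real)" "(1, 1)"]
      has_bochner_integral_indicator[of "cbox (0 :: real, 0 :: real) (1, 1)" lborel c] by simp
qed

text \<open>Since \<open>hesse_ratio\<close> is bounded by 3, the logarithmic series is dominated by
  a geometric series of ratio 3|w| < 1 and may be integrated term by term.\<close>

lemma has_bochner_integral_Ln_hesse: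
  assumes "cmod w < 1/3"
  shows "has_bochner_integral lborel
     (\<lambda>p. indicator ({0..1} \<times> {0..1}) p *\<^sub>R Ln (1 - w * hesse_ratio p))
     (- cubic_L (27 * w ^ 3) / 3)"
proof -
  define Sq where "Sq = ({0..1} \<times> {0..1} :: (real \<times> real) set)"
  \<comment> \<open>The term m = 0 is a division by zero, hence 0, in agreement with the logarithmic
    series.\<close>
  define f where "f m p = indicator Sq p *\<^sub>R (- ((w * hesse_ratio p) ^ m) / of_nat m)"
    for m :: nat and p
  define q where "q = 3 * cmod w"
  have q: "0 \<le> q" "q < 1" using assms by (auto simp: q_def)
  have small: "cmod (w * hesse_ratio p) \<le> q" for p
    using mult_left_mono[OF norm_hesse_ratio_le[of p] norm_ge_zero[of w]]
    by (simp add: q_def norm_mult mult.commute)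
  have f_le: "norm (f m p) \<le> indicator Sq p *\<^sub>R q ^ m" for m p
  proof -
    have "cmod ((w * hesse_ratio p) ^ m / of_nat m) \<le> cmod (w * hesse_ratio p) ^ m"
      unfolding norm_divide norm_power norm_of_nat
      using divide_left_mono[of 1 "real m" "cmod (w * hesse_ratio p) ^ m"] by (cases m) auto
    also have "\<dots> \<le> q ^ m" by (intro power_mono small) auto
    finally show ?thesis by (simp add: f_def indicator_def norm_divide)
  qed
  have f_int: "has_bochner_integral lborel (f m)
      (if 3 dvd m then - (w ^ m) / of_nat m * (fact m / fact (m div 3) ^ 3) else 0)" for m
    using has_bochner_integral_mult_right[OF integral_hesse_ratio_power[of m],
        of "- (w ^ m) / of_nat m"]
    by (simp add: f_def[abs_def] Sq_def power_mult_distrib if_distrib cong: if_cong)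
  have ind: "has_bochner_integral lborel (\<lambda>p. indicator Sq p *\<^sub>R q ^ m) (q ^ m)" for m
    unfolding Sq_def by (rule has_bochner_integral_const_unit_square)
  have 1: "integrable lborel (f m)" for m using f_int by (auto simp: has_bochner_integral_iff)
  have 2: "summable (\<lambda>m. norm (f m p))" for p
  proof (rule summable_comparison_test')
    show "summable (\<lambda>m. indicator Sq p *\<^sub>R q ^ m)" using q
      by (intro summable_scaleR_right summable_geometric) auto
  qed (use f_le in auto)
  have 3: "summable (\<lambda>m. \<integral>p. norm (f m p) \<partial>lborel)"
  proof (rule summable_comparison_test')
    show "summable (\<lambda>m. q ^ m)" using q by (intro summable_geometric) auto
    fix m :: nat
    have "(\<integral>p. norm (f m p) \<partial>lborel) \<le> (\<integral>p. indicator Sq p *\<^sub>R q ^ m \<partial>lborel)"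
      using 1 ind f_le by (intro integral_mono integrable_norm) (auto simp: has_bochner_integral_iff)
    also have "\<dots> = q ^ m" using ind[of m] by (rule has_bochner_integral_integral_eq)
    finally show "norm (\<integral>p. norm (f m p) \<partial>lborel) \<le> q ^ m" by simp
  qed
  have sum_f: "(\<Sum>m. f m p) = indicator Sq p *\<^sub>R Ln (1 - w * hesse_ratio p)" for p
  proof -
    have "cmod (- (w * hesse_ratio p)) < 1" using small[of p] q by simp
    from Ln_series'[OF this]
    have "(\<lambda>m. f m p) sums (indicator Sq p *\<^sub>R Ln (1 - w * hesse_ratio p))"
      unfolding f_def by (intro sums_scaleR_right) simp
    thus ?thesis by (simp add: sums_iff)
  qed
  have s: "(\<lambda>m. integral\<^sup>L lborel (f m)) sums
      (\<integral>p. indicator Sq p *\<^sub>R Ln (1 - w * hesse_ratio p) \<partial>lborel)"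
    using sums_integral[of lborel f] 1 2 3 by (simp add: sum_f)
  have i: "integrable lborel (\<lambda>p. indicator Sq p *\<^sub>R Ln (1 - w * hesse_ratio p))"
    using integrable_suminf[of lborel f] 1 2 3 by (simp add: sum_f)
  \<comment> \<open>Integrals with m not divisible by 3 vanish, so the sum runs over m = 3n; the
    factor 1/(3n) is the source of the 1/3.\<close>
  have "(\<lambda>n. integral\<^sup>L lborel (f (3 * n))) sums
      (\<integral>p. indicator Sq p *\<^sub>R Ln (1 - w * hesse_ratio p) \<partial>lborel)"
    using s
    by (subst sums_mono_reindex[where f = "\<lambda>m. integral\<^sup>L lborel (f m)" and g = "\<lambda>n. 3 * n"])
       (use f_int in \<open>auto simp: strict_mono_def has_bochner_integral_iff dvd_def image_iff\<close>)
  also have "(\<lambda>n. integral\<^sup>L lborel (f (3 * n))) =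
      (\<lambda>n. (- 1/3) * (cubic_coeff n / of_nat n * (27 * w ^ 3) ^ n))"
    using f_int by (auto simp: has_bochner_integral_iff cubic_coeff_def power_mult_distrib
        fun_eq_iff field_simps simp flip: power_mult)
  finally have s': "(\<lambda>n. (- 1/3) * (cubic_coeff n / of_nat n * (27 * w ^ 3) ^ n)) sums
      (\<integral>p. indicator Sq p *\<^sub>R Ln (1 - w * hesse_ratio p) \<partial>lborel)" .
  have "(\<lambda>n. cubic_coeff n / of_nat n * (27 * w ^ 3) ^ n) sums
      (- 3 * (\<integral>p. indicator Sq p *\<^sub>R Ln (1 - w * hesse_ratio p) \<partial>lborel))"
    using sums_mult[OF s', of "-3"] by simp
  hence "cubic_L (27 * w ^ 3) =
      - 3 * (\<integral>p. indicator Sq p *\<^sub>R Ln (1 - w * hesse_ratio p) \<partial>lborel)"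
    unfolding cubic_L_def by (simp add: sums_iff)
  thus ?thesis using i by (simp add: has_bochner_integral_iff Sq_def)
qed

text \<open>On the torus the polynomial equals -(3/r) x y (1 - (r/3) \<open>hesse_ratio\<close>)
  with |x y| = 1, and the real part of \<open>Ln\<close> is the logarithm of the modulus.\<close>

lemma mahler2_hesse:
  assumes "r \<noteq> 0" "cmod r < 1"
  shows "mahler2 (\<lambda>x y. x ^ 3 + y ^ 3 + 1 - (3 / r) * x * y) =
    ln 3 - ln (cmod r) - Re (cubic_L (r ^ 3)) / 3"
proof -
  define Sq where "Sq = ({0..1} \<times> {0..1} :: (real \<times> real) set)"
  have "cmod (r / 3) < 1/3" using assms by (simp add: norm_divide)
  from has_bochner_integral_Ln_hesse[OF this]
  have I: "has_bochner_integral lborel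
     (\<lambda>p. indicator Sq p *\<^sub>R Ln (1 - r / 3 * hesse_ratio p)) (- cubic_L (r ^ 3) / 3)"
    by (simp add: Sq_def power_divide)
  have J: "has_bochner_integral lborel (\<lambda>p. indicator Sq p *\<^sub>R ln (3 / cmod r)) (ln (3 / cmod r))"
    unfolding Sq_def by (rule has_bochner_integral_const_unit_square)
  have eq: "indicator Sq p *\<^sub>R ln (cmod (cis (2 * pi * fst p) ^ 3 + cis (2 * pi * snd p) ^ 3 + 1
        - (3 / r) * cis (2 * pi * fst p) * cis (2 * pi * snd p)))
      = indicator Sq p *\<^sub>R ln (3 / cmod r)
        + Re (indicator Sq p *\<^sub>R Ln (1 - r / 3 * hesse_ratio p))" for p
  proof -
    define x y where "x = cis (2 * pi * fst p)" and "y = cis (2 * pi * snd p)"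
    have xy: "x \<noteq> 0" "y \<noteq> 0" "cmod x = 1" "cmod y = 1" by (auto simp: x_def y_def)
    have h: "hesse_ratio p = (x ^ 3 + y ^ 3 + 1) / (x * y)"
      by (simp add: hesse_ratio_def x_def y_def)
    have "cmod (r / 3 * hesse_ratio p) \<le> cmod r / 3 * 3"
      unfolding norm_mult by (intro mult_mono norm_hesse_ratio_le) (auto simp: norm_divide)
    \<comment> \<open>The product has modulus at most |r| < 1, so the polynomial has no zero on the
      torus.\<close>
    hence nz: "1 - r / 3 * hesse_ratio p \<noteq> 0" using assms by auto
    have "x ^ 3 + y ^ 3 + 1 - (3 / r) * x * y = - (3 / r) * (x * y) * (1 - r / 3 * hesse_ratio p)"
      unfolding h using assms xy by (simp add: field_simps)
    hence "cmod (x ^ 3 + y ^ 3 + 1 - (3 / r) * x * y) = 3 / cmod r * cmod (1 - r / 3 * hesse_ratio p)"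
      by (simp add: norm_mult norm_divide xy)
    hence "ln (cmod (x ^ 3 + y ^ 3 + 1 - (3 / r) * x * y)) =
        ln (3 / cmod r) + Re (Ln (1 - r / 3 * hesse_ratio p))"
      using assms nz ln_mult[of "3 / cmod r" "cmod (1 - r / 3 * hesse_ratio p)"]
      by (simp only: Re_Ln) simp
    thus ?thesis by (simp add: x_def y_def algebra_simps)
  qed
  have "mahler2 (\<lambda>x y. x ^ 3 + y ^ 3 + 1 - (3 / r) * x * y) =
      (\<integral>p. indicator Sq p *\<^sub>R ln (3 / cmod r)
        + Re (indicator Sq p *\<^sub>R Ln (1 - r / 3 * hesse_ratio p)) \<partial>lborel)"
    unfolding mahler2_def set_lebesgue_integral_def Sq_def[symmetric] eq ..
  also have "\<dots> = ln (3 / cmod r) + Re (- cubic_L (r ^ 3) / 3)"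
    by (intro has_bochner_integral_integral_eq has_bochner_integral_add J
        has_bochner_integral_bounded_linear[OF bounded_linear_Re I])
  finally show ?thesis using assms by (simp add: ln_div)
qed

text \<open>The value in \<open>mahler2_hesse\<close> depends on r only through |r| and r^3, so
  every cube root of t would give the same result.\<close>

lemma nfun_eq:
  assumes "t \<noteq> 0" "cmod t < 1"
  shows "nfun t = ln 3 - ln (cmod t) / 3 - Re (cubic_L t) / 3"
proof -
  define r where "r = t powr (1/3)"
  have r3: "r ^ 3 = t"
    using assms powr_power[of t "1/3" 3] by (simp add: r_def powr_power)
  have n3: "cmod r ^ 3 = cmod t" by (simp flip: r3 add: norm_power)
  have r: "r \<noteq> 0" using r3 assms by auto
  have "cmod r < 1"
    using n3 assms(2) by (metis linorder_not_le one_le_power)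
  moreover have "ln (cmod t) = 3 * ln (cmod r)"
    using r by (simp flip: n3 add: ln_realpow)
  ultimately show ?thesis
    using mahler2_hesse[OF r] r3 by (simp add: nfun_def r_def)
qed

section \<open>Summation over the cube roots of unity\<close>

text \<open>The function \<open>\<Phi>(u) = L(Y(u)) + ln (Y(u) / 9u)\<close>, written so that it makes sense at 0.\<close>

definition isogeny_log :: "complex \<Rightarrow> complex" where
  "isogeny_log u = cubic_L (Yfun u) + Ln (1 + u + u\<^sup>2) - 3 * Ln (1 + 2 * u)"

definition isogeny_log' :: "complex \<Rightarrow> complex" where
  "isogeny_log' u = cubic_L' (Yfun u) * (9 * (1 - u)\<^sup>2 / (1 + 2 * u) ^ 4)
     + (1 + 2 * u) / (1 + u + u\<^sup>2) - 6 / (1 + 2 * u)"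

lemma isogeny_log_0 [simp]: "isogeny_log 0 = 0"
  by (simp add: isogeny_log_def Yfun_def)

lemma DERIV_isogeny_log:
  assumes u: "cmod u \<le> 1/100"
  shows "(isogeny_log has_field_derivative isogeny_log' u) (at u within A)"
proof -
  note nz = small_disc_nonzero[OF u]
  have "cmod (u\<^sup>2) \<le> (1/100)\<^sup>2"
    unfolding norm_power using u by (intro power_mono) auto
  hence *: "\<bar>Re (u\<^sup>2)\<bar> \<le> 1/100" "\<bar>Re u\<bar> \<le> 1/100"
    using abs_Re_le_cmod[of u] abs_Re_le_cmod[of "u\<^sup>2"] u by (auto simp: power2_eq_square)
  \<comment> \<open>Positive real parts keep both principal logarithms away from the branch
    cut.\<close>
  have re: "Re (1 + u + u\<^sup>2) > 0" "Re (1 + 2 * u) > 0"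
  proof -
    have "Re (1 + u + u\<^sup>2) = 1 + Re u + Re (u\<^sup>2)" "Re (1 + 2 * u) = 1 + 2 * Re u" by simp_all
    with *
    show "Re (1 + u + u\<^sup>2) > 0" "Re (1 + 2 * u) > 0" by linarith+
  qed
  have ln1: "((\<lambda>u. Ln (1 + u + u\<^sup>2)) has_field_derivative (1 + 2 * u) / (1 + u + u\<^sup>2)) (at u within A)"
    using re(1)
    by (auto intro!: derivative_eq_intros simp: complex_nonpos_Reals_iff divide_inverse mult.commute)
  have ln2: "((\<lambda>u. 3 * Ln (1 + 2 * u)) has_field_derivative 6 / (1 + 2 * u)) (at u within A)"
    using re(2)
    by (auto intro!: derivative_eq_intros simp: complex_nonpos_Reals_iff divide_inverse mult.commute)
  show ?thesis
    unfolding isogeny_log_def[abs_def] isogeny_log'_def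
    by (intro DERIV_diff DERIV_add ln1 ln2 DERIV_cubic_L DERIV_Yfun nz norm_Yfun_less_1 u)
qed

lemma isogeny_log'_mult:
  assumes u: "cmod u \<le> 1/100"
  shows "u * isogeny_log' u = (1 - u) ^ 3 / (1 - u ^ 3) * cubic_F (u ^ 3) - 1"
proof -
  note nz = small_disc_nonzero[OF u]
  define F where "F = cubic_F (u ^ 3)"
  define L where "L = cubic_L' (Yfun u)"
  have "Yfun u * L = (1 + 2 * u) * F - 1"
    unfolding L_def F_def
    by (simp add: cubic_L'_mult[OF norm_Yfun_less_1[OF u]] cubic_transformation[OF u])
  \<comment> \<open>Solving for 9 u L rather than L avoids dividing by u, so u = 0 is
    covered.\<close>
  hence L: "9 * u * L = ((1 + 2 * u) * F - 1) * (1 + 2 * u) ^ 3 / (1 + u + u\<^sup>2)"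
    using nz by (simp add: Yfun_eq field_simps)
  have "u * isogeny_log' u = (9 * u * L) * ((1 - u)\<^sup>2 / (1 + 2 * u) ^ 4)
      + u * (1 + 2 * u) / (1 + u + u\<^sup>2) - 6 * u / (1 + 2 * u)"
    by (simp add: isogeny_log'_def L_def algebra_simps)
  \<comment> \<open>All terms free of F combine to -1.\<close>
  also have "\<dots> = (1 - u)\<^sup>2 / (1 + u + u\<^sup>2) * F - 1"
    unfolding L using nz(1,3) by (simp add: divide_simps) algebra
  \<comment> \<open>Extending by 1 - u produces a denominator invariant under rotation by
    \<open>zeta3\<close>.\<close>
  also have "(1 - u)\<^sup>2 / (1 + u + u\<^sup>2) = (1 - u) ^ 3 / (1 - u ^ 3)"
    using nz by (simp add: divide_simps) algebra
  finally show ?thesis by (simp add: F_def)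
qed

lemma zeta3_cubed: "zeta3 ^ 3 = 1"
  by (simp add: zeta3_def Complex.DeMoivre)

lemma norm_zeta3_power [simp]: "cmod (zeta3 ^ j) = 1"
  by (simp add: zeta3_def norm_power)

lemma zeta3_sum: "1 + zeta3 + zeta3\<^sup>2 = 0"
proof -
  have "zeta3 \<noteq> 1"
    using cos_120 by (simp add: zeta3_def complex_eq_iff)
  moreover have "(zeta3 - 1) * (1 + zeta3 + zeta3\<^sup>2) = 0"
    using zeta3_cubed by algebra
  ultimately show ?thesis by simp
qed

lemma cubic_L_cubed_eq_sum:
  assumes u: "cmod u < 1/100"
  shows "cubic_L (u ^ 3) = (\<Sum>j\<le>2. isogeny_log (zeta3 ^ j * u))"
proof -
  define D where "D u = cubic_L (u ^ 3) - (\<Sum>j\<le>2. isogeny_log (zeta3 ^ j * u))" for u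
  have "(D has_field_derivative 0) (at u within ball 0 (1/100))" if "u \<in> ball 0 (1/100)" for u
  proof -
    have u: "cmod u < 1/100" using that by simp
    define D' where "D' = cubic_L' (u ^ 3) * (3 * u\<^sup>2)
      - (\<Sum>j\<le>2. isogeny_log' (zeta3 ^ j * u) * zeta3 ^ j)"
    have j: "cmod (zeta3 ^ j * u) \<le> 1/100" for j :: nat
      using u by (simp add: norm_mult)
    note nz = small_disc_nonzero[OF less_imp_le[OF u]]
    have u3: "cmod (u ^ 3) < 1" using small_disc_bounds(7)[of u] u by auto
    have L: "((\<lambda>u. cubic_L (u ^ 3)) has_field_derivative cubic_L' (u ^ 3) * (3 * u\<^sup>2))
        (at u within ball 0 (1/100))"
      using u3 by (auto intro!: derivative_eq_intros)
    have "((\<lambda>u. zeta3 ^ j * u) has_field_derivative zeta3 ^ j) (at u within ball 0 (1/100))" for j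
      by (auto intro!: derivative_eq_intros)
    note I = DERIV_chain2[OF DERIV_isogeny_log[OF j] this]
    have "(D has_field_derivative D') (at u within ball 0 (1/100))"
      unfolding D_def[abs_def] D'_def by (intro DERIV_diff L DERIV_sum I)
    moreover have "D' = 0"
    proof (cases "u = 0")
      \<comment> \<open>At 0 nothing can be recovered from u D', but there D' is a multiple of the
        sum of the cube roots of unity.\<close>
      case True
      have "D' = - isogeny_log' 0 * (1 + zeta3 + zeta3\<^sup>2)"
        unfolding D'_def True by (simp add: numeral_2_eq_2 algebra_simps)
      thus ?thesis by (simp add: zeta3_sum)
    next
      case False
      have cube: "(zeta3 ^ j * u) ^ 3 = u ^ 3" for j
      proof -
        have "(zeta3 ^ j) ^ 3 = (zeta3 ^ 3) ^ j" by (simp only: power_mult[symmetric] mult.commute)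
        thus ?thesis by (simp add: power_mult_distrib zeta3_cubed)
      qed
      \<comment> \<open>The linear and quadratic terms cancel over the cube roots of unity, while
        each cubic term contributes -u^3.\<close>
      have cubes: "(\<Sum>j\<le>2. (1 - zeta3 ^ j * u) ^ 3) = 3 * (1 - u ^ 3)"
      proof -
        have "(1 - u) ^ 3 + (1 - zeta3 * u) ^ 3 + (1 - zeta3\<^sup>2 * u) ^ 3 = 3 * (1 - u ^ 3)"
          using zeta3_sum by algebra
        thus ?thesis by (simp add: numeral_2_eq_2)
      qed
      have avg: "(\<Sum>j\<le>2. (1 - zeta3 ^ j * u) ^ 3 / (1 - u ^ 3)) = 3"
        by (simp only: sum_divide_distrib[symmetric] cubes nonzero_mult_div_cancel_right[OF nz(4)])
      have "u * D' = 3 * (u ^ 3 * cubic_L' (u ^ 3))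
          - (\<Sum>j\<le>2. (zeta3 ^ j * u) * isogeny_log' (zeta3 ^ j * u))"
        by (simp add: D'_def algebra_simps sum_distrib_left power2_eq_square power3_eq_cube)
      also have "(\<Sum>j\<le>2. (zeta3 ^ j * u) * isogeny_log' (zeta3 ^ j * u)) =
          (\<Sum>j\<le>2. (1 - zeta3 ^ j * u) ^ 3 / (1 - u ^ 3)) * cubic_F (u ^ 3) - 3"
        unfolding isogeny_log'_mult[OF j] cube
        by (simp add: sum_subtractf sum_distrib_right)
      also have "3 * (u ^ 3 * cubic_L' (u ^ 3)) = 3 * cubic_F (u ^ 3) - 3"
        by (simp add: cubic_L'_mult[OF u3])
      finally have "u * D' = 0" by (simp add: avg)
      thus ?thesis using False by simp
    qed
    ultimately show ?thesis by simp
  qed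
  then obtain c where c: "\<And>x. x \<in> ball 0 (1/100) \<Longrightarrow> D x = c"
    using has_field_derivative_zero_constant[of "ball 0 (1/100)" D] by auto
  have "D u = D 0" using c[of u] c[of 0] u by simp
  thus ?thesis by (simp add: D_def)
qed

text \<open>The factor 9 in Y contributes 2 ln 3 to ln |Y|, which lowers the constant from ln 3 to
  ln 3 / 3; the remaining factors are absorbed by \<open>isogeny_log\<close>.\<close>

lemma nfun_Yfun:
  assumes "u \<noteq> 0" "cmod u < 1/100"
  shows "nfun (Yfun u) = ln 3 / 3 - ln (cmod u) / 3 - Re (isogeny_log u) / 3"
proof -
  have u: "cmod u \<le> 1/100" using assms by simp
  note nz = small_disc_nonzero[OF u]
  have "Yfun u \<noteq> 0" using nz assms by (simp add: Yfun_eq)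
  hence "nfun (Yfun u) = ln 3 - ln (cmod (Yfun u)) / 3 - Re (cubic_L (Yfun u)) / 3"
    using nfun_eq norm_Yfun_less_1[OF u] by blast
  moreover have "ln (cmod (Yfun u)) =
      2 * ln 3 + ln (cmod u) + ln (cmod (1 + u + u\<^sup>2)) - 3 * ln (cmod (1 + 2 * u))"
  proof -
    have "cmod (Yfun u) = 3 ^ 2 * cmod u * cmod (1 + u + u\<^sup>2) / cmod (1 + 2 * u) ^ 3"
      using nz by (simp add: Yfun_eq norm_divide norm_mult norm_power)
    thus ?thesis using nz assms by (simp only: ln_div ln_mult ln_realpow) (simp add: ln_mult ln_div ln_realpow)
  qed
  ultimately show ?thesis using nz by (simp add: isogeny_log_def field_simps)
qed

theorem mainTheorem7:
  shows "\<exists>\<epsilon>>0. \<forall>u::complex. 0 < cmod u \<and> cmod u < \<epsilon> \<longrightarrow>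
           nfun (u ^ 3) = (\<Sum>j\<in>{0..2::nat}. nfun (Yfun (zeta3 ^ j * u)))"
proof (intro exI[of _ "1/100"] conjI allI impI)
  fix u :: complex assume "0 < cmod u \<and> cmod u < 1/100"
  hence u: "u \<noteq> 0" "cmod u < 1/100" by auto
  have "cmod (u ^ 3) < 1" using small_disc_bounds(7)[of u] u by auto
  hence "nfun (u ^ 3) = ln 3 - ln (cmod u) - Re (cubic_L (u ^ 3)) / 3"
    using nfun_eq[of "u ^ 3"] u by (simp add: norm_power ln_realpow)
  \<comment> \<open>Rotation preserves |u|, so the three elementary parts add up to ln 3 - ln |u|,
    the one found for n(u^3).\<close>
  moreover have "nfun (Yfun (zeta3 ^ j * u)) =
      ln 3 / 3 - ln (cmod u) / 3 - Re (isogeny_log (zeta3 ^ j * u)) / 3" for j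
  proof -
    have "zeta3 ^ j \<noteq> 0" using norm_zeta3_power[of j] by force
    thus ?thesis using nfun_Yfun[of "zeta3 ^ j * u"] u by (simp add: norm_mult)
  qed
  ultimately show "nfun (u ^ 3) = (\<Sum>j\<in>{0..2}. nfun (Yfun (zeta3 ^ j * u)))"
    by (simp add: cubic_L_cubed_eq_sum[OF u(2)] atMost_atLeast0 sum_subtractf
        flip: sum_divide_distrib)
qed simp

end
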